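(* Let $\mathcal{P}^d_0$ be the set of $d$-dimensional convex polytopes in $\mathbb{R}^d$ containing the origin in their interior, and let $\mathcal{A}_d$ be the real vector space of functions $\mathbb{R}^d\to\mathbb{R}$ spanned by the indicator functions $[P]$ of $P\in\mathcal{P}^d_0$, which is an $\mathbb{R}$-algebra under pointwise multiplication (since $[A][B]=[A\cap B]$). Then $\mathcal{A}_d$ is generated as an $\mathbb{R}$-algebra by the indicator functions $[P]$ of those $P\in\mathcal{P}^d_0$ with $P=-P^\circ$.
   Context: The indicator function $[A]$ of $A\subseteq\mathbb{R}^d$ is $[A](x)=1$ if $x\in A$ and $0$ otherwise. For $A\subseteq\mathbb{R}^d$, the polar is $A^\circ=\{x:\langle x,a\rangle\le 1\text{ for all }a\in A\}$ and $-A=\{-a:a\in A\}$. *)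

theory Defs
  imports "HOL-Analysis.Analysis" "HOL-Library.Function_Algebras"
begin

text \<open>Pointwise scalar multiplication; together with the pointwise ring operations of
  \<^theory>\<open>HOL-Library.Function_Algebras\<close> it makes \<open>'a \<Rightarrow> real\<close> a real algebra, so that
  the library's \<open>span\<close> and \<open>subspace\<close> apply to sets of real functions.\<close>

instantiation "fun" :: (type, real_vector) real_vector
begin

definition scaleR_fun :: "real \<Rightarrow> ('a \<Rightarrow> 'b) \<Rightarrow> 'a \<Rightarrow> 'b"
  where "scaleR_fun c f = (\<lambda>x. c *\<^sub>R f x)"

instance
  by standard (simp_all add: scaleR_fun_def fun_eq_iff scaleR_add_right scaleR_add_left)

end

lemma scaleR_fun_apply [simp]: "(c *\<^sub>R f) x = c *\<^sub>R f x"
  by (simp add: scaleR_fun_def)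

instance "fun" :: (type, real_algebra) real_algebra
  by standard (simp_all add: fun_eq_iff)

text \<open>Subalgebras are not required to contain a unit: linear combinations of indicator functions
  of polytopes have bounded support, so the constant function \<open>1\<close> is not among them.\<close>

definition subalgebra_real :: "'a::real_algebra set \<Rightarrow> bool"
  where "subalgebra_real A \<longleftrightarrow> subspace A \<and> (\<forall>f\<in>A. \<forall>g\<in>A. f * g \<in> A)"

definition algebra_generated_by :: "'a::real_algebra set \<Rightarrow> 'a set"
  where "algebra_generated_by S = subalgebra_real hull S"

definition polar :: "'a::real_inner set \<Rightarrow> 'a set"
  where "polar A = {x. \<forall>a\<in>A. x \<bullet> a \<le> 1}"

definition polytopes0 :: "(real^'n) set set"
  where "polytopes0 = {P. polytope P \<and> aff_dim P = int CARD('n) \<and> 0 \<in> interior P}"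

definition polytope_algebra :: "(real^'n \<Rightarrow> real) set"
  where "polytope_algebra = span (indicator ` polytopes0)"

end

theory Submission
  imports Defs
begin

text \<open>Write \<open>A\<^sup>*\<close> for \<open>neg_polar A\<close>, the set of all \<open>x\<close> with \<open>x \<bullet> a \<ge> -1\<close> on \<open>A\<close>. A polytope \<open>A \<subseteq> A\<^sup>*\<close>
  with \<open>0\<close> in its interior lies in a polytope \<open>Q = Q\<^sup>*\<close>: go through the orthants \<open>C\<close> one by one, replacing
  \<open>A\<close> by the convex hull of \<open>A \<union> (A\<^sup>* \<inter> C)\<close>. Since inner products are nonnegative on \<open>C\<close>, this keeps
  \<open>A \<subseteq> A\<^sup>*\<close>, and \<open>A\<^sup>*\<close> only shrinks, so that in the end \<open>A\<^sup>* \<inter> C \<subseteq> A\<close> for every \<open>C\<close>.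
  If \<open>P\<close> is contained in the half-space \<open>H = {x. v \<bullet> x \<le> 1}\<close>, then for each orthant \<open>C\<close> the polytope
  spanned by \<open>P \<inter> C\<close>, \<open>-v\<close> and a small box around \<open>0\<close> extends to such a \<open>Q\<close>, and \<open>-v \<in> Q\<close> forces
  \<open>Q \<subseteq> H\<close>. The union of these \<open>Q\<close> thus lies between \<open>P\<close> and \<open>H\<close>, and \<open>P\<close> is the intersection of
  such unions over its facets.\<close>

section \<open>Calculus of the negated polar\<close>

definition neg_polar :: "'a::real_inner set \<Rightarrow> 'a set"
  where "neg_polar A = uminus ` polar A"

lemma mem_neg_polar: "x \<in> neg_polar A \<longleftrightarrow> (\<forall>a\<in>A. - 1 \<le> x \<bullet> a)"
proof -
  have "x \<in> neg_polar A \<longleftrightarrow> - x \<in> polar A"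
    unfolding neg_polar_def by (metis (no_types, lifting) image_iff minus_minus)
  then show ?thesis
    by (force simp: polar_def)
qed

lemma convex_neg_polar: "convex (neg_polar A)"
proof -
  have "neg_polar A = (\<Inter>a\<in>A. {x. a \<bullet> x \<ge> - 1})"
    by (auto simp: mem_neg_polar inner_commute)
  then show ?thesis
    by (auto intro: convex_INT convex_halfspace_ge)
qed

text \<open>Both inclusions say that every point of \<open>A\<close> has inner product at least -1
  with every point of \<open>B\<close>, a symmetric condition. This Galois connection drives the
  hull lemmas below.\<close>

lemma subset_neg_polar_commute: "A \<subseteq> neg_polar B \<longleftrightarrow> B \<subseteq> neg_polar A"
  unfolding subset_iff mem_neg_polar by (metis inner_commute)

lemma neg_polar_antimono: "A \<subseteq> B \<Longrightarrow> neg_polar B \<subseteq> neg_polar A"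
  unfolding subset_iff mem_neg_polar by blast

text \<open>Negated polars are convex, so the hull can be taken on one side of the inclusion; after
  swapping sides it can be taken on the other.\<close>

lemma convex_hull_subset_neg_polar:
  assumes "S \<subseteq> neg_polar S"
  shows "convex hull S \<subseteq> neg_polar (convex hull S)"
proof -
  have "convex hull S \<subseteq> neg_polar S"
    by (rule hull_minimal[of S _ convex]) (use assms convex_neg_polar in auto)
  then have "S \<subseteq> neg_polar (convex hull S)"
    by (simp only: subset_neg_polar_commute)
  then show ?thesis
    by (rule hull_minimal[of S _ convex]) (rule convex_neg_polar)
qed

lemma neg_polar_convex_hull: "neg_polar (convex hull S) = neg_polar S"
proof
  show "neg_polar (convex hull S) \<subseteq> neg_polar S"
    by (intro neg_polar_antimono hull_subset)
  have "convex hull S \<subseteq> neg_polar (neg_polar S)"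
    by (rule hull_minimal[of S _ convex])
      (use convex_neg_polar subset_neg_polar_commute in blast)+
  then show "neg_polar S \<subseteq> neg_polar (convex hull S)"
    by (simp only: subset_neg_polar_commute)
qed

text \<open>Each of the finitely many points spanning \<open>A\<close> contributes one half-space,
  so the result is a polyhedron; a ball around the origin inside \<open>A\<close> makes it
  bounded.\<close>

lemma polytope_neg_polar:
  fixes A :: "'a::euclidean_space set"
  assumes "polytope A" and "0 \<in> interior A"
  shows "polytope (neg_polar A)"
proof -
  obtain V where V: "finite V" "A = convex hull V"
    using assms(1) unfolding polytope_def by blast
  have "neg_polar A = (\<Inter>a\<in>V. {x. a \<bullet> x \<ge> - 1})"
    unfolding V(2) neg_polar_convex_hull
    by (auto simp: mem_neg_polar inner_commute)
  then have "polyhedron (neg_polar A)"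
    using V(1) by (auto intro: polyhedron_Inter polyhedron_halfspace_ge)
  moreover obtain e where e: "e > 0" "cball 0 e \<subseteq> A"
    using assms(2) by (meson mem_interior_cball)
  have "norm x \<le> 1 / e" if "x \<in> neg_polar A" for x
  proof (cases "x = 0")
    case False
    \<comment> \<open>The point of the ball opposite to \<open>x\<close>, where the inner product
      with \<open>x\<close> is least.\<close>
    define y where "y = (- (e / norm x)) *\<^sub>R x"
    have "norm y = e"
      using False e by (simp add: y_def)
    then have "- 1 \<le> x \<bullet> y"
      using that e by (auto simp: mem_neg_polar)
    also have "x \<bullet> y = - (e * norm x)"
      using False by (simp add: y_def power2_norm_eq_inner[symmetric] power2_eq_square)
    finally show ?thesis
      using e by (simp add: field_simps)
  qed (use e in simp)
  then have "bounded (neg_polar A)"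
    by (meson boundedI)
  ultimately show ?thesis
    by (simp add: polytope_eq_bounded_polyhedron)
qed

section \<open>Enlarging a polytope to one equal to its negated polar\<close>

lemma polytope_convex_hull_Un:
  assumes "polytope A" and "polytope B"
  shows "polytope (convex hull (A \<union> B))"
proof -
  obtain V W where "finite V" "A = convex hull V" "finite W" "B = convex hull W"
    using assms unfolding polytope_def by blast
  moreover have "convex hull (convex hull V \<union> convex hull W) = convex hull (V \<union> W)"
    by (simp only: hull_Un_left[symmetric] hull_Un_right[symmetric])
  ultimately show ?thesis
    unfolding polytope_def by (metis finite_UnI)
qed

lemma polytope_Int_polyhedron:
  fixes A :: "'a::euclidean_space set"
  shows "polytope A \<Longrightarrow> polyhedron B \<Longrightarrow> polytope (A \<inter> B)"
  by (metis bounded_Int polyhedron_Int polytope_eq_bounded_polyhedron)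

lemma extend_self_polar_cells:
  fixes A :: "'a::euclidean_space set"
  assumes "finite \<C>" and "\<And>C. C \<in> \<C> \<Longrightarrow> polyhedron C" and "\<And>C. C \<in> \<C> \<Longrightarrow> C \<subseteq> neg_polar C"
    and "polytope A" and "0 \<in> interior A" and "A \<subseteq> neg_polar A"
  shows "\<exists>Q. polytope Q \<and> A \<subseteq> Q \<and> Q \<subseteq> neg_polar Q \<and> (\<forall>C\<in>\<C>. neg_polar Q \<inter> C \<subseteq> Q)"
  using assms(1-3)
proof (induction \<C>)
  case empty
  then show ?case
    using assms by blast
next
  case (insert C \<C>)
  then obtain Q where Q: "polytope Q" "A \<subseteq> Q" "Q \<subseteq> neg_polar Q"
    and cells: "\<And>D. D \<in> \<C> \<Longrightarrow> neg_polar Q \<inter> D \<subseteq> Q"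
    by (metis insertCI)
  have "0 \<in> interior Q"
    using assms(5) interior_mono[OF Q(2)] by blast
  define S where "S = Q \<union> (neg_polar Q \<inter> C)"
  have "polytope (convex hull S)"
    unfolding S_def
    using Q(1) \<open>0 \<in> interior Q\<close> insert.prems(1)
    by (intro polytope_convex_hull_Un polytope_Int_polyhedron polytope_neg_polar) auto
  moreover have "S \<subseteq> convex hull S" "Q \<subseteq> convex hull S"
    using hull_subset[of S convex] by (auto simp: S_def)
  moreover have "S \<subseteq> neg_polar S"
  proof -
    have "C \<subseteq> neg_polar C"
      using insert.prems by blast
    \<comment> \<open>Two points of \<open>Q\<close> are compatible by induction, two points of
      \<open>C\<close> by \<open>C \<subseteq> neg_polar C\<close>, and mixed pairs because the new
      points lie in \<open>neg_polar Q\<close>.\<close>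
    then show ?thesis
      using Q(3) unfolding S_def subset_iff mem_neg_polar Ball_def Un_iff Int_iff
      by (metis inner_commute)
  qed
  moreover have "neg_polar (convex hull S) \<subseteq> neg_polar Q"
    using \<open>Q \<subseteq> convex hull S\<close> by (rule neg_polar_antimono)
  moreover have "neg_polar (convex hull S) \<inter> D \<subseteq> convex hull S" if "D \<in> insert C \<C>" for D
  proof (cases "D = C")
    case True
    then show ?thesis
      using \<open>S \<subseteq> convex hull S\<close> \<open>neg_polar (convex hull S) \<subseteq> neg_polar Q\<close>
      unfolding S_def by blast
  next
    \<comment> \<open>Cells treated earlier stay settled: \<open>Q\<close> has grown and its negated
      polar has shrunk.\<close>
    case False
    then show ?thesis
      using that cells[of D] \<open>Q \<subseteq> convex hull S\<close>
        \<open>neg_polar (convex hull S) \<subseteq> neg_polar Q\<close> by blast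
  qed
  ultimately show ?case
    using Q(2) convex_hull_subset_neg_polar[of S]
    by (intro exI[of _ "convex hull S"]) blast
qed

section \<open>Orthants as cells\<close>

text \<open>The sign pattern is encoded by the set \<open>T\<close> of nonnegative coordinates, so
  that \<open>Pow Basis\<close> is a finite index set. The orthants are closed and share their
  walls.\<close>

definition orthant :: "'a::euclidean_space set \<Rightarrow> 'a set"
  where "orthant T = {x. \<forall>b\<in>Basis. if b \<in> T then 0 \<le> b \<bullet> x else b \<bullet> x \<le> 0}"

lemma polyhedron_orthant: "polyhedron (orthant T)"
proof -
  have "orthant T = (\<Inter>b\<in>Basis. if b \<in> T then {x. b \<bullet> x \<ge> 0} else {x. b \<bullet> x \<le> 0})"
    by (auto simp: orthant_def split: if_splits)
  then show ?thesis
    by (auto intro!: polyhedron_Inter polyhedron_halfspace_ge polyhedron_halfspace_le)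
qed

text \<open>Corresponding coordinates never have opposite signs, so every term of the inner product
  is nonnegative.\<close>

lemma inner_orthant_nonneg:
  assumes "x \<in> orthant T" and "y \<in> orthant T"
  shows "0 \<le> x \<bullet> y"
proof -
  have "0 \<le> (x \<bullet> b) * (y \<bullet> b)" if "b \<in> Basis" for b
    using assms that
    by (cases "b \<in> T") (simp_all add: orthant_def inner_commute mult_nonpos_nonpos)
  then show ?thesis
    by (subst euclidean_inner) (intro sum_nonneg)
qed

lemma Union_orthants: "(\<Union>T\<in>Pow Basis. orthant T) = (UNIV :: 'a::euclidean_space set)"
proof (intro equalityI subsetI)
  fix x :: 'a
  show "x \<in> (\<Union>T\<in>Pow Basis. orthant T)"
  proof (rule UN_I)
    show "{b \<in> Basis. 0 \<le> b \<bullet> x} \<in> Pow Basis"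
      by blast
    show "x \<in> orthant {b \<in> Basis. 0 \<le> b \<bullet> x}"
      by (auto simp: orthant_def)
  qed
qed simp

lemma extend_self_polar:
  fixes A :: "'a::euclidean_space set"
  assumes "polytope A" and "0 \<in> interior A" and "A \<subseteq> neg_polar A"
  obtains Q where "polytope Q" and "A \<subseteq> Q" and "Q = neg_polar Q"
proof -
  have "- 1 \<le> x \<bullet> y" if "x \<in> orthant T" "y \<in> orthant T" for x y :: 'a and T
    using inner_orthant_nonneg[OF that] by linarith
  then have "orthant T \<subseteq> neg_polar (orthant T)" for T :: "'a set"
    by (simp add: subset_iff mem_neg_polar)
  then have "\<exists>Q. polytope Q \<and> A \<subseteq> Q \<and> Q \<subseteq> neg_polar Q \<and>
      (\<forall>C\<in>orthant ` Pow Basis. neg_polar Q \<inter> C \<subseteq> Q)"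
    by (intro extend_self_polar_cells assms) (auto intro: polyhedron_orthant)
  then obtain Q where Q: "polytope Q" "A \<subseteq> Q" "Q \<subseteq> neg_polar Q"
    and cells: "\<forall>C\<in>orthant ` Pow Basis. neg_polar Q \<inter> C \<subseteq> Q"
    by blast
  have "neg_polar Q \<subseteq> Q"
    using cells Union_orthants[where ?'a = 'a] by blast
  with Q show thesis
    using that by blast
qed

text \<open>The enlargement starts from the hull of \<open>P \<inter> orthant T\<close>,
  \<open>- v\<close> and a box. The point \<open>- v\<close> imposes the half-space, the box
  supplies interior, and cutting \<open>P\<close> by an orthant makes its points pairwise
  compatible.\<close>

lemma self_polar_cover_orthant:
  fixes P :: "'a::euclidean_space set"
  assumes "polytope P" and "\<And>x. x \<in> P \<Longrightarrow> v \<bullet> x \<le> 1"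
  obtains Q where "polytope Q" and "0 \<in> interior Q" and "Q = neg_polar Q"
    and "P \<inter> orthant T \<subseteq> Q" and "\<And>x. x \<in> Q \<Longrightarrow> v \<bullet> x \<le> 1"
proof -
  define N where "N = P \<inter> orthant T"
  have "polytope N"
    unfolding N_def using assms(1) polyhedron_orthant by (rule polytope_Int_polyhedron)
  then have "bounded (insert (- v) N)"
    by (simp add: polytope_imp_bounded)
  then obtain R0 where R0: "\<And>x. x \<in> insert (- v) N \<Longrightarrow> norm x \<le> R0"
    by (meson bounded_iff)
  \<comment> \<open>The lower bound 1 gives \<open>1 / R \<le> R\<close>, so that points of the box
    are also compatible with each other.\<close>
  define R where "R = max R0 1"
  have R: "R \<ge> 1" "\<And>x. x \<in> insert (- v) N \<Longrightarrow> norm x \<le> R"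
    using R0 by (auto simp: R_def max_def intro: order_trans)
  \<comment> \<open>A box, unlike a ball, keeps the hull a polytope. The radius \<open>1 / R\<close>
    bounds by 1 all products with vectors of norm at most \<open>R\<close>.\<close>
  obtain a b where ab: "0 \<in> box a b" "cbox a b \<subseteq> ball (0::'a) (1 / R)"
    using R(1) open_contains_cbox[of "ball (0::'a) (1 / R)" 0] by (metis centre_in_ball open_ball
        less_le_trans zero_less_divide_1_iff zero_less_one)
  have small: "norm x \<le> 1 / R" if "x \<in> cbox a b" for x
    using ab(2) that by (auto simp: subset_iff less_imp_le)
  define S where "S = (insert (- v) N) \<union> cbox a b"
  have box: "- 1 \<le> x \<bullet> y" if "x \<in> cbox a b" "y \<in> S" for x y
  proof -
    have "1 / R \<le> R"
      using R(1) by (intro order_trans[of "1 / R" 1 R]) simp_all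
    then have "norm y \<le> R"
      using that(2) R(2) small by (fastforce simp: S_def)
    then have "norm x * norm y \<le> (1 / R) * R"
      using small[OF that(1)] R(1) by (intro mult_mono) auto
    then show ?thesis
      using Cauchy_Schwarz_ineq2[of x y] R(1) by simp
  qed
  have N: "- 1 \<le> x \<bullet> y" if "x \<in> insert (- v) N" "y \<in> insert (- v) N" for x y
  proof -
    have "v \<bullet> z \<le> 1" "z \<bullet> v \<le> 1" if "z \<in> N" for z
      using that assms(2) by (simp_all add: N_def inner_commute[of z v])
    moreover have "- 1 \<le> x \<bullet> y" if "x \<in> N" "y \<in> N"
      using that inner_orthant_nonneg[of x T y] by (simp add: N_def)
    moreover have "- 1 \<le> v \<bullet> v"
      using inner_ge_zero[of v] by linarith
    ultimately show ?thesis
      using that by (elim insertE) simp_all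
  qed
  have "S \<subseteq> neg_polar S"
  proof
    fix x assume "x \<in> S"
    then have "- 1 \<le> x \<bullet> y" if "y \<in> S" for y
      using that box[of x y] box[of y x] N[of x y] unfolding S_def
      by (auto simp: inner_commute)
    then show "x \<in> neg_polar S"
      by (simp add: mem_neg_polar)
  qed
  then have "convex hull S \<subseteq> neg_polar (convex hull S)"
    by (rule convex_hull_subset_neg_polar)
  moreover have "polytope (convex hull S)"
  proof -
    have "S = {- v} \<union> N \<union> cbox a b"
      by (simp add: S_def)
    then have "convex hull S = convex hull (convex hull ({- v} \<union> N) \<union> cbox a b)"
      by (metis hull_Un_left)
    moreover have "polytope (convex hull ({- v} \<union> N))"
      by (intro polytope_convex_hull_Un polytope_sing \<open>polytope N\<close>)
    ultimately show ?thesis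
      by (simp only: polytope_convex_hull_Un polytope_interval)
  qed
  moreover have sub: "S \<subseteq> convex hull S"
    by (rule hull_subset)
  have "box a b \<subseteq> interior (convex hull S)"
    using sub box_subset_cbox[of a b] by (intro interior_maximal) (auto simp: S_def)
  ultimately obtain Q where Q: "polytope Q" "convex hull S \<subseteq> Q" "Q = neg_polar Q"
    using extend_self_polar ab(1) by blast
  show thesis
  proof
    show "0 \<in> interior Q"
      using \<open>box a b \<subseteq> interior (convex hull S)\<close> interior_mono[OF Q(2)] ab(1) by blast
    show "P \<inter> orthant T \<subseteq> Q"
      using sub Q(2) by (auto simp: S_def N_def)
    show "v \<bullet> x \<le> 1" if "x \<in> Q" for x
    proof -
      have "- v \<in> Q"
        using sub Q(2) by (auto simp: S_def)
      then have "- v \<in> neg_polar Q"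
        by (simp only: Q(3)[symmetric])
      then have "- 1 \<le> - v \<bullet> x"
        using that by (simp only: mem_neg_polar)
      then show ?thesis
        by simp
    qed
  qed (fact Q)+
qed

section \<open>Indicator functions and subalgebras\<close>

lemma polytopes0_iff: "P \<in> polytopes0 \<longleftrightarrow> polytope P \<and> 0 \<in> interior P"
  using aff_dim_nonempty_interior[of P] by (auto simp: polytopes0_def)

lemma Int_polytopes0: "P \<in> polytopes0 \<Longrightarrow> Q \<in> polytopes0 \<Longrightarrow> P \<inter> Q \<in> polytopes0"
  by (simp add: polytopes0_iff polytope_Int)

lemma indicator_times: "indicator A * indicator B = (indicator (A \<inter> B) :: 'a \<Rightarrow> real)"
  by (simp add: fun_eq_iff indicator_inter_arith)

text \<open>Multiplication is bilinear: expand the right factor against a fixed generator, then the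
  left factor.\<close>

lemma subalgebra_real_span:
  assumes "\<And>x y. x \<in> S \<Longrightarrow> y \<in> S \<Longrightarrow> x * y \<in> span S"
  shows "subalgebra_real (span S)"
  unfolding subalgebra_real_def
proof (intro conjI ballI)
  fix f g assume f: "f \<in> span S" and g: "g \<in> span S"
  have left: "x * g \<in> span S" if "x \<in> S" for x
    using g
  proof (induction rule: span_induct_alt)
    case base
    then show ?case by (simp add: span_zero)
  next
    case (step c y z)
    then show ?case
      using assms[OF that step(1)] by (simp add: distrib_left span_add span_scale)
  qed
  show "f * g \<in> span S"
    using f
  proof (induction rule: span_induct_alt)
    case base
    then show ?case by (simp add: span_zero)
  next
    case (step c y z)
    then show ?case
      using left[OF step(1)] by (simp add: distrib_right span_add span_scale)
  qed
qed simp

lemma subalgebra_real_algebra_generated_by: "subalgebra_real (algebra_generated_by S)"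
  unfolding algebra_generated_by_def
  by (rule hull_in) (auto simp: subalgebra_real_def intro: subspace_Inter)

text \<open>Inclusion-exclusion for two sets, \<open>[A \<union> B] = [A] + [B] - [A][B]\<close>, is
  iterated; the empty union gives the zero function.\<close>

lemma indicator_UN_mem_subalgebra:
  assumes "subalgebra_real \<A>" and "finite I" and "\<And>i. i \<in> I \<Longrightarrow> indicator (X i) \<in> \<A>"
  shows "(indicator (\<Union>i\<in>I. X i) :: 'a \<Rightarrow> real) \<in> \<A>"
  using assms(2,3)
proof (induction I)
  case empty
  have "(indicator {} :: 'a \<Rightarrow> real) = 0"
    by (simp add: fun_eq_iff)
  then show ?case
    using assms(1) subspace_0[of \<A>] by (simp only: subalgebra_real_def image_empty Union_empty)
next
  case (insert i I)
  let ?U = "\<Union>i\<in>I. X i"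
  have "(indicator (X i \<union> ?U) :: 'a \<Rightarrow> real) =
      indicator (X i) + indicator ?U - indicator (X i) * indicator ?U"
    by (simp add: fun_eq_iff indicator_def)
  moreover have "indicator (X i) + indicator ?U - indicator (X i) * indicator ?U \<in> \<A>"
    using assms(1) insert unfolding subalgebra_real_def
    by (intro subspace_add subspace_diff) auto
  ultimately show ?case
    by (simp only: UN_insert)
qed

text \<open>\<open>L\<close> is the union of one self-polar polytope per orthant: each lies in the
  half-space, and together they cover \<open>P\<close>.\<close>

lemma separating_set:
  fixes \<A> :: "(real^'n \<Rightarrow> real) set"
  assumes alg: "subalgebra_real \<A>"
    and gen: "\<And>Q. Q \<in> polytopes0 \<Longrightarrow> Q = neg_polar Q \<Longrightarrow> indicator Q \<in> \<A>"
    and "polytope P" and "P \<subseteq> {x. v \<bullet> x \<le> 1}"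
  obtains L where "indicator L \<in> \<A>" and "P \<subseteq> L" and "L \<subseteq> {x. v \<bullet> x \<le> 1}"
proof -
  have "\<exists>Q. Q \<in> polytopes0 \<and> Q = neg_polar Q \<and> P \<inter> orthant T \<subseteq> Q \<and> Q \<subseteq> {x. v \<bullet> x \<le> 1}" for T
  proof -
    obtain Q where "polytope Q" "0 \<in> interior Q" "Q = neg_polar Q"
      "P \<inter> orthant T \<subseteq> Q" "\<And>x. x \<in> Q \<Longrightarrow> v \<bullet> x \<le> 1"
      using self_polar_cover_orthant[of P v T] assms(3,4) by blast
    then show ?thesis
      unfolding polytopes0_iff by blast
  qed
  then obtain Q where Q: "\<And>T. Q T \<in> polytopes0" "\<And>T. Q T = neg_polar (Q T)"
    "\<And>T. P \<inter> orthant T \<subseteq> Q T" "\<And>T. Q T \<subseteq> {x. v \<bullet> x \<le> 1}"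
    by metis
  show thesis
  proof
    show "indicator (\<Union>T\<in>Pow Basis. Q T) \<in> \<A>"
      by (intro indicator_UN_mem_subalgebra[OF alg] gen Q(1,2)) simp
    show "P \<subseteq> (\<Union>T\<in>Pow Basis. Q T)"
    proof
      fix x assume "x \<in> P"
      obtain T where "T \<in> Pow Basis" "x \<in> orthant T"
        using Union_orthants[where ?'a = "real^'n"] by (metis UNIV_I UN_E)
      with \<open>x \<in> P\<close> show "x \<in> (\<Union>T\<in>Pow Basis. Q T)"
        by (intro UN_I subsetD[OF Q(3)] IntI)
    qed
    show "(\<Union>T\<in>Pow Basis. Q T) \<subseteq> {x. v \<bullet> x \<le> 1}"
      by (intro UN_least Q(4))
  qed
qed

lemma indicator_polytopes0_mem_subalgebra:
  fixes \<A> :: "(real^'n \<Rightarrow> real) set"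
  assumes alg: "subalgebra_real \<A>"
    and gen: "\<And>Q. Q \<in> polytopes0 \<Longrightarrow> Q = neg_polar Q \<Longrightarrow> indicator Q \<in> \<A>"
    and P: "P \<in> polytopes0"
  shows "indicator P \<in> \<A>"
proof -
  have "polytope P" "0 \<in> interior P"
    using P by (auto simp: polytopes0_iff)
  then obtain F where F: "finite F" "P = \<Inter>F"
    and half: "\<And>h. h \<in> F \<Longrightarrow> \<exists>a b. a \<noteq> 0 \<and> h = {x. a \<bullet> x \<le> b}"
    using polytope_imp_polyhedron unfolding polyhedron_def by metis
  have normalized: "\<exists>v. h = {x. v \<bullet> x \<le> 1}" if "h \<in> F" for h
  proof -
    obtain a b where ab: "a \<noteq> 0" "h = {x. a \<bullet> x \<le> b}"
      using half[OF \<open>h \<in> F\<close>] by blast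
    \<comment> \<open>An interior point satisfies the inequality strictly, so \<open>b\<close> is
      positive and can be scaled to 1.\<close>
    have "0 \<in> interior h"
      using \<open>0 \<in> interior P\<close> F(2) that by (metis Inter_lower interior_mono subsetD)
    then have "b > 0"
      using ab by simp
    then have "h = {x. (a /\<^sub>R b) \<bullet> x \<le> 1}"
      by (auto simp: ab(2) field_simps)
    then show ?thesis by blast
  qed
  have "\<exists>L. indicator L \<in> \<A> \<and> P \<subseteq> L \<and> L \<subseteq> \<Inter>G" if "finite G" "G \<subseteq> F" for G
    using that
  proof (induction G)
    case empty
    \<comment> \<open>The empty intersection is the whole space, but \<open>\<A>\<close> may lack
      the constant function 1. With \<open>v = 0\<close> the half-space is everything, and any set
      containing \<open>P\<close> with indicator in \<open>\<A>\<close> will do.\<close>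
    obtain L where "indicator L \<in> \<A>" "P \<subseteq> L"
      using separating_set[OF alg gen \<open>polytope P\<close>, of 0] by auto
    then show ?case by auto
  next
    case (insert h G)
    then obtain L where L: "indicator L \<in> \<A>" "P \<subseteq> L" "L \<subseteq> \<Inter>G"
      by blast
    obtain v where v: "h = {x. v \<bullet> x \<le> 1}"
      using normalized insert.prems by blast
    then have "P \<subseteq> {x. v \<bullet> x \<le> 1}"
      using F(2) insert.prems by blast
    then obtain M where M: "indicator M \<in> \<A>" "P \<subseteq> M" "M \<subseteq> h"
      using separating_set[OF alg gen \<open>polytope P\<close>] v by metis
    have "indicator (L \<inter> M) \<in> \<A>"
      using alg L(1) M(1) unfolding subalgebra_real_def by (metis indicator_times)
    then show ?case
      using L M by (intro exI[of _ "L \<inter> M"]) auto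
  qed
  \<comment> \<open>For \<open>G = F\<close> the set \<open>L\<close> is squeezed between
    \<open>P\<close> and \<open>\<Inter>F = P\<close>.\<close>
  from this[OF F(1)] show ?thesis
    using F(2) by (metis subset_antisym subset_refl)
qed

theorem theorem8p3:
  shows "subalgebra_real (polytope_algebra :: (real^'n \<Rightarrow> real) set) \<and>
    algebra_generated_by
      {indicator P :: real^'n \<Rightarrow> real | P. P \<in> polytopes0 \<and> P = uminus ` polar P}
    = polytope_algebra"
proof
  show alg: "subalgebra_real (polytope_algebra :: (real^'n \<Rightarrow> real) set)"
    unfolding polytope_algebra_def
  proof (rule subalgebra_real_span)
    fix f g :: "real^'n \<Rightarrow> real"
    assume "f \<in> indicator ` polytopes0" "g \<in> indicator ` polytopes0"
    then obtain P Q where "P \<in> polytopes0" "f = indicator P" "Q \<in> polytopes0" "g = indicator Q"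
      by blast
    then have "P \<inter> Q \<in> polytopes0" and "f * g = indicator (P \<inter> Q)"
      by (simp_all only: Int_polytopes0 indicator_times)
    then have "f * g \<in> indicator ` polytopes0"
      by blast
    then show "f * g \<in> span (indicator ` polytopes0)"
      by (rule span_base)
  qed
  define S :: "(real^'n \<Rightarrow> real) set"
    where "S = {indicator P | P. P \<in> polytopes0 \<and> P = uminus ` polar P}"
  have S: "indicator Q \<in> S" if "Q \<in> polytopes0" "Q = neg_polar Q" for Q
    unfolding S_def using that[unfolded neg_polar_def] by (intro CollectI exI[of _ Q] conjI refl)
  have "algebra_generated_by S = polytope_algebra"
  proof
    have "S \<subseteq> indicator ` polytopes0"
      unfolding S_def by blast
    then have "S \<subseteq> polytope_algebra"
      unfolding polytope_algebra_def using span_superset by (rule subset_trans)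
    then show "algebra_generated_by S \<subseteq> polytope_algebra"
      unfolding algebra_generated_by_def using alg by (rule hull_minimal)
    have "S \<subseteq> algebra_generated_by S"
      unfolding algebra_generated_by_def by (rule hull_subset)
    then have "indicator Q \<in> algebra_generated_by S"
      if "Q \<in> polytopes0" "Q = neg_polar Q" for Q
      using S[OF that] by (rule subsetD)
    \<comment> \<open>The generated algebra itself serves as the subalgebra
      \<open>\<A>\<close>.\<close>
    then have "indicator P \<in> algebra_generated_by S" if "P \<in> polytopes0" for P
      by (rule indicator_polytopes0_mem_subalgebra[OF subalgebra_real_algebra_generated_by _ that])
    then have "indicator ` polytopes0 \<subseteq> algebra_generated_by S"
      by blast
    moreover have "subspace (algebra_generated_by S)"
      using subalgebra_real_algebra_generated_by[of S] unfolding subalgebra_real_def by blast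
    ultimately show "polytope_algebra \<subseteq> algebra_generated_by S"
      unfolding polytope_algebra_def by (rule span_minimal)
  qed
  then show "algebra_generated_by
      {indicator P :: real^'n \<Rightarrow> real | P. P \<in> polytopes0 \<and> P = uminus ` polar P}
    = polytope_algebra"
    unfolding S_def .
qed

end
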